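(* Let $\mu=(R\cos\delta,R\sin\delta)\in\mathbb{R}^2$ with $R\ge 0$, $\delta\in\mathbb{R}$, and let $\gamma:\mathbb{R}\to \mathrm{SE}(2)$ be an arc-length parameterized sub-Riemannian geodesic with momentum $\mu$ (that is, a geodesic corresponding to the curve $\alpha_\mu=\{(p_\theta,\theta)\in T^*\mathrm{SO}(2): 1=p_\theta^2+R^2\cos^2(\theta-\delta)\}$). Then $\gamma$ is periodic (there is $T>0$ with $\gamma(t+T)=\gamma(t)$ for all $t\in\mathbb{R}$) if and only if $R=0$.
   Context: $\mathrm{SE}(2)=\mathrm{SO}(2)\ltimes\mathbb{R}^2$ is the special Euclidean group of the plane, with coordinates $(\theta,x,y)$, $\theta\in\mathbb{R}/2\pi\mathbb{Z}$, $(x,y)\in\mathbb{R}^2$. It carries the left-invariant sub-Riemannian structure whose distribution $\mathcal{D}$ has the orthonormal frame $X_\theta=\frac{\partial}{\partial\theta}$, $X_u=\cos\theta\frac{\partial}{\partial x}+\sin\theta\frac{\partial}{\partial y}$. With canonical coordinates $(p_\theta,p_x,p_y,\theta,x,y)$ on $T^*\mathrm{SE}(2)$, the sub-Riemannian geodesic flow is the Hamiltonian flow of $H_{sR}=\frac12\big(p_\theta^2+(p_x\cos\theta+p_y\sin\theta)^2\big)$. An arc-length parameterized geodesic is the projection $\gamma:\mathbb{R}\to\mathrm{SE}(2)$ of a solution of this flow with $H_{sR}=\frac12$. The functions $p_x,p_y$ are constants of motion; $\gamma$ has momentum $\mu$ if $(p_x,p_y)=\mu$ along the solution. One writes $\mu=(R\cos\delta,R\sin\delta)$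 with $R\ge0$ (also denoted $\mu=(R,\delta)$). For a geodesic of momentum $\mu$, the pair $(p_\theta(t),\theta(t))$ lies in $\alpha_\mu$ and solves $\dot p_\theta=R^2\cos(\theta-\delta)\sin(\theta-\delta)$, $\dot\theta=p_\theta$, and $\dot\gamma=\dot\theta X_\theta(\gamma)+R\cos(\theta-\delta)X_u(\gamma)$. *)

theory Defs
  imports "HOL-Analysis.Analysis"
begin

definition SE2 :: "((real^2^2) \<times> (real^2)) set" where
  "SE2 = {(A, v). rotation_matrix A}"

text \<open>The coordinates \<open>(\<theta>, x, y)\<close> on SE(2). The angle is taken in \<open>\<real>\<close> here and
  the passage to \<open>\<real>/2\<pi>\<int>\<close> is performed by this map; see \<open>SE2_coords_eq_iff\<close> and
  \<open>range_SE2_coords\<close>.\<close>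

definition SE2_coords :: "real \<times> real \<times> real \<Rightarrow> (real^2^2) \<times> (real^2)" where
  "SE2_coords = (\<lambda>(\<theta>, x, y).
     (vector [vector [cos \<theta>, - sin \<theta>], vector [sin \<theta>, cos \<theta>]], vector [x, y]))"

lemma SE2_coords_eq_iff:
  "SE2_coords (\<theta>, x, y) = SE2_coords (\<theta>', x', y') \<longleftrightarrow>
     (\<exists>n::int. \<theta> = \<theta>' + 2 * pi * n) \<and> x = x' \<and> y = y'"
  using sin_cos_eq_iff[of \<theta> \<theta>']
  by (auto simp: SE2_coords_def vec_eq_iff forall_2)

lemma range_SE2_coords: "range SE2_coords = SE2"
proof (intro equalityI subsetI)
  fix g assume "g \<in> range SE2_coords"
  then show "g \<in> SE2"
    by (auto simp: SE2_coords_def SE2_def rotation_matrix_def orthogonal_matrix det_2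
        matrix_matrix_mult_def transpose_def mat_def vec_eq_iff forall_2 sum_2
        simp flip: power2_eq_square)
next
  fix g assume "g \<in> SE2"
  then obtain A v where g: "g = (A, v)" and A: "orthogonal_matrix A" "det A = 1"
    by (auto simp: SE2_def rotation_matrix_def)
  define a b c d where abcd: "a = A$1$1" "b = A$1$2" "c = A$2$1" "d = A$2$2"
  have 1: "a * a + c * c = 1" and 2: "a * b + c * d = 0" and 3: "b * b + d * d = 1"
    using A(1) unfolding orthogonal_matrix abcd
    by (auto simp: matrix_matrix_mult_def transpose_def mat_def vec_eq_iff forall_2 sum_2)
  have 4: "a * d - b * c = 1" using A(2) by (simp add: det_2 abcd)
  have "(a - d)^2 + (b + c)^2 = 0"
    using 1 3 4 by (simp add: power2_eq_square algebra_simps)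
  then have 5: "d = a" "b = - c"
    by (auto simp: sum_power2_eq_zero_iff)
  from 1 have "a\<^sup>2 + c\<^sup>2 = 1" by (simp add: power2_eq_square)
  then obtain t where "a = cos t" "c = sin t"
    using sincos_total_2pi by metis
  then have "g = SE2_coords (t, v$1, v$2)"
    using 5 unfolding g by (simp add: SE2_coords_def vec_eq_iff forall_2 abcd)
  then show "g \<in> range SE2_coords" by simp
qed

text \<open>Hamilton's equations \<open>q' = \<partial>H/\<partial>p\<close>, \<open>p' = - \<partial>H/\<partial>q\<close>, solved on all of \<open>\<real>\<close>.\<close>

definition hamiltonian_curve ::
    "('a::real_inner \<Rightarrow> 'a \<Rightarrow> real) \<Rightarrow> (real \<Rightarrow> 'a) \<Rightarrow> (real \<Rightarrow> 'a) \<Rightarrow> bool" where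
  "hamiltonian_curve H p q \<longleftrightarrow>
     (\<forall>t. \<exists>Hp Hq. GDERIV (\<lambda>p'. H p' (q t)) (p t) :> Hp \<and>
                  GDERIV (\<lambda>q'. H (p t) q') (q t) :> Hq \<and>
                  (q has_vector_derivative Hp) (at t) \<and>
                  (p has_vector_derivative - Hq) (at t))"

definition H_sR :: "real \<times> real \<times> real \<Rightarrow> real \<times> real \<times> real \<Rightarrow> real" where
  "H_sR = (\<lambda>(p\<^sub>\<theta>, p\<^sub>x, p\<^sub>y) (\<theta>, x, y). 1/2 * (p\<^sub>\<theta>\<^sup>2 + (p\<^sub>x * cos \<theta> + p\<^sub>y * sin \<theta>)\<^sup>2))"

text \<open>A solution of the flow on \<open>T\<^sup>*SE(2)\<close> is represented by its lift to real-valued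
  \<open>\<theta>\<close>; the lift exists because \<open>\<real>\<close> is simply connected, and \<open>H_sR\<close> is
  \<open>2\<pi>\<close>-periodic in \<open>\<theta>\<close>.\<close>

definition sR_geodesic_momentum :: "real \<times> real \<Rightarrow> (real \<Rightarrow> (real^2^2) \<times> (real^2)) \<Rightarrow> bool" where
  "sR_geodesic_momentum \<mu> \<gamma> \<longleftrightarrow>
     (\<exists>p q. hamiltonian_curve H_sR p q \<and> (\<forall>t. H_sR (p t) (q t) = 1/2) \<and>
            (\<forall>t. snd (p t) = \<mu>) \<and> (\<forall>t. \<gamma> t = SE2_coords (q t)))"

text \<open>On covectors of momentum \<open>\<mu>\<close>, the level \<open>H_sR = 1/2\<close> is the curve \<open>\<alpha>\<^sub>\<mu>\<close>.\<close>

lemma H_sR_eq_half_iff: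
  "H_sR (p\<^sub>\<theta>, R * cos \<delta>, R * sin \<delta>) (\<theta>, x, y) = 1/2 \<longleftrightarrow> 1 = p\<^sub>\<theta>\<^sup>2 + R\<^sup>2 * (cos (\<theta> - \<delta>))\<^sup>2"
proof -
  have "R * cos \<delta> * cos \<theta> + R * sin \<delta> * sin \<theta> = R * cos (\<theta> - \<delta>)"
    by (simp add: cos_diff algebra_simps)
  then show ?thesis by (auto simp: H_sR_def power_mult_distrib)
qed

lemma hamiltonian_curve_H_sR_iff:
  "hamiltonian_curve H_sR (\<lambda>t. (p\<^sub>\<theta> t, p\<^sub>x t, p\<^sub>y t)) (\<lambda>t. (\<theta> t, x t, y t)) \<longleftrightarrow>
   (\<forall>t. let c = p\<^sub>x t * cos (\<theta> t) + p\<^sub>y t * sin (\<theta> t) in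
      (\<theta> has_real_derivative p\<^sub>\<theta> t) (at t) \<and>
      (x has_real_derivative c * cos (\<theta> t)) (at t) \<and>
      (y has_real_derivative c * sin (\<theta> t)) (at t) \<and>
      (p\<^sub>\<theta> has_real_derivative c * (p\<^sub>x t * sin (\<theta> t) - p\<^sub>y t * cos (\<theta> t))) (at t) \<and>
      (p\<^sub>x has_real_derivative 0) (at t) \<and> (p\<^sub>y has_real_derivative 0) (at t))"
proof -
  have gp: "GDERIV (\<lambda>p'. H_sR p' (b, u, v)) (a, m, n) :>
      (a, (m * cos b + n * sin b) * cos b, (m * cos b + n * sin b) * sin b)" for a b m n u v :: real
    unfolding gderiv_def H_sR_def case_prod_beta
    by (auto intro!: derivative_eq_intros simp: fun_eq_iff algebra_simps)
  have gq: "GDERIV (\<lambda>q'. H_sR (a, m, n) q') (b, u, v) :>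
      ((m * cos b + n * sin b) * (n * cos b - m * sin b), 0, 0)" for a b m n u v :: real
    unfolding gderiv_def H_sR_def case_prod_beta
    by (auto intro!: derivative_eq_intros simp: fun_eq_iff algebra_simps)
  have uniq: "D = E" if "GDERIV f z :> D" "GDERIV f z :> E" for f :: "real \<times> real \<times> real \<Rightarrow> real" and z D E
    using that unfolding gderiv_def
    by (metis has_derivative_unique inner_eq_zero_iff inner_diff_right right_minus_eq)
  have tri: "((\<lambda>t. (f t, g t, h t)) has_vector_derivative (f', g', h')) (at t) \<longleftrightarrow>
     (f has_real_derivative f') (at t) \<and> (g has_real_derivative g') (at t) \<and>
     (h has_real_derivative h') (at t)" (is "?L \<longleftrightarrow> ?R") for f g h :: "real \<Rightarrow> real" and f' g' h' t
  proof
    assume ?L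
    then have L: "((\<lambda>t. (f t, g t, h t)) has_derivative (\<lambda>s. s *\<^sub>R (f', g', h'))) (at t)"
      by (simp add: has_vector_derivative_def)
    from has_derivative_fst[OF L] has_derivative_fst[OF has_derivative_snd[OF L]]
      has_derivative_snd[OF has_derivative_snd[OF L]]
    show ?R by (simp add: has_field_derivative_def mult_commute_abs)
  next
    assume ?R
    then show ?L
      by (auto simp: has_real_derivative_iff_has_vector_derivative intro!: has_vector_derivative_Pair)
  qed
  have reduce: "(\<exists>Hp Hq. GDERIV (\<lambda>p'. H_sR p' (\<theta> t, x t, y t)) (p\<^sub>\<theta> t, p\<^sub>x t, p\<^sub>y t) :> Hp \<and>
              GDERIV (\<lambda>q'. H_sR (p\<^sub>\<theta> t, p\<^sub>x t, p\<^sub>y t) q') (\<theta> t, x t, y t) :> Hq \<and> P Hp Hq) \<longleftrightarrow>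
     P (p\<^sub>\<theta> t, (p\<^sub>x t * cos (\<theta> t) + p\<^sub>y t * sin (\<theta> t)) * cos (\<theta> t),
          (p\<^sub>x t * cos (\<theta> t) + p\<^sub>y t * sin (\<theta> t)) * sin (\<theta> t))
       ((p\<^sub>x t * cos (\<theta> t) + p\<^sub>y t * sin (\<theta> t)) * (p\<^sub>y t * cos (\<theta> t) - p\<^sub>x t * sin (\<theta> t)), 0, 0)" for P t
    using gp[of "\<theta> t" "x t" "y t" "p\<^sub>\<theta> t" "p\<^sub>x t" "p\<^sub>y t"]
      gq[of "p\<^sub>\<theta> t" "p\<^sub>x t" "p\<^sub>y t" "\<theta> t" "x t" "y t"]
    by (metis (no_types, lifting) uniq)
  have neg: "- (c * (n - m)) = c * (m - n)" for c m n :: real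
    by (simp add: algebra_simps)
  show ?thesis
    unfolding hamiltonian_curve_def Let_def reduce
    by (simp only: uminus_Pair tri neg minus_zero conj_assoc)
qed

end

theory Submission
  imports Defs
begin

text \<open>Along a geodesic of momentum \<open>(p\<^sub>x, p\<^sub>y)\<close> the function \<open>p\<^sub>x x + p\<^sub>y y\<close> has derivative \<open>c\<^sup>2\<close> with
  \<open>c = p\<^sub>x cos \<theta> + p\<^sub>y sin \<theta>\<close>. If the geodesic is periodic, this function is periodic and
  nondecreasing, hence constant, so \<open>c = 0\<close>. Then \<open>p\<^sub>\<theta> = \<plusminus>1\<close>, so \<open>\<theta>\<close> moves and \<open>c\<close> can only vanish
  identically if the momentum is zero. Conversely, for zero momentum the geodesic rotates in place
  with unit speed.\<close>

text \<open>Monotonicity traps the values on a period between \<open>f t\<close> and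
  \<open>f (t + T) = f t\<close>, so \<open>f\<close> cannot increase.\<close>

lemma periodic_deriv_nonneg_imp_deriv_zero:
  fixes f f' :: "real \<Rightarrow> real"
  assumes deriv: "\<And>t. (f has_real_derivative f' t) (at t)"
    and nonneg: "\<And>t. f' t \<ge> 0" and "T > 0" and period: "\<And>t. f (t + T) = f t"
  shows "f' t = 0"
proof -
  have mono: "f a \<le> f b" if "a \<le> b" for a b
    using that deriv nonneg by (meson DERIV_nonneg_imp_nondecreasing)
  have "f t = f s" if "\<bar>t - s\<bar> < T" for s
    using that mono[of t s] mono[of s t] mono[of s "t + T"] mono[of t "s + T"] period[of s] period[of t]
    by linarith
  then show ?thesis
    by (blast intro: DERIV_local_const[OF deriv \<open>T > 0\<close>])
qed

text \<open>Splits the product-valued curves into scalar functions, so that Hamilton's equations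
  become real ODEs with the constant momentum substituted; \<open>\<theta>\<close> is a real-valued
  lift of the angle.\<close>

lemma sR_geodesic_momentumE:
  assumes "sR_geodesic_momentum (m, n) \<gamma>"
  obtains \<theta> x y p where
    "\<And>t. \<gamma> t = SE2_coords (\<theta> t, x t, y t)"
    "\<And>t. (p t)\<^sup>2 + (m * cos (\<theta> t) + n * sin (\<theta> t))\<^sup>2 = 1"
    "\<And>t. (\<theta> has_real_derivative p t) (at t)"
    "\<And>t. (x has_real_derivative (m * cos (\<theta> t) + n * sin (\<theta> t)) * cos (\<theta> t)) (at t)"
    "\<And>t. (y has_real_derivative (m * cos (\<theta> t) + n * sin (\<theta> t)) * sin (\<theta> t)) (at t)"
    "\<And>t. (p has_real_derivative
        (m * cos (\<theta> t) + n * sin (\<theta> t)) * (m * sin (\<theta> t) - n * cos (\<theta> t))) (at t)"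
proof -
  obtain P q where H: "hamiltonian_curve H_sR P q" and E: "\<And>t. H_sR (P t) (q t) = 1/2"
    and \<mu>: "\<And>t. snd (P t) = (m, n)" and \<gamma>: "\<And>t. \<gamma> t = SE2_coords (q t)"
    using assms by (auto simp: sR_geodesic_momentum_def)
  define p \<theta> x y where "p = fst \<circ> P" and "\<theta> = fst \<circ> q" and "x = fst \<circ> snd \<circ> q" and "y = snd \<circ> snd \<circ> q"
  have P: "P = (\<lambda>t. (p t, m, n))" and q: "q = (\<lambda>t. (\<theta> t, x t, y t))"
    using \<mu> by (auto simp: p_def \<theta>_def x_def y_def fun_eq_iff prod_eq_iff)
  have "(p t)\<^sup>2 + (m * cos (\<theta> t) + n * sin (\<theta> t))\<^sup>2 = 1" for t
    using E[of t] by (simp add: P q H_sR_def del: distrib_left_numeral)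
  then show ?thesis
    using H \<gamma> unfolding P q hamiltonian_curve_H_sR_iff Let_def by (intro that[of \<theta> x y p]) simp_all
qed

theorem periodic_sR_geodesic_iff:
  assumes "sR_geodesic_momentum (m, n) \<gamma>"
  shows "(\<exists>T>0. \<forall>t. \<gamma> (t + T) = \<gamma> t) \<longleftrightarrow> m = 0 \<and> n = 0"
proof (rule sR_geodesic_momentumE[OF assms])
  fix \<theta> x y p
  assume \<gamma>: "\<And>t. \<gamma> t = SE2_coords (\<theta> t, x t, y t)"
    and energy: "\<And>t. (p t)\<^sup>2 + (m * cos (\<theta> t) + n * sin (\<theta> t))\<^sup>2 = 1"
    and d\<theta>: "\<And>t. (\<theta> has_real_derivative p t) (at t)"
    and dx: "\<And>t. (x has_real_derivative (m * cos (\<theta> t) + n * sin (\<theta> t)) * cos (\<theta> t)) (at t)"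
    and dy: "\<And>t. (y has_real_derivative (m * cos (\<theta> t) + n * sin (\<theta> t)) * sin (\<theta> t)) (at t)"
    and dp: "\<And>t. (p has_real_derivative
        (m * cos (\<theta> t) + n * sin (\<theta> t)) * (m * sin (\<theta> t) - n * cos (\<theta> t))) (at t)"
  show ?thesis
  proof
    assume "\<exists>T>0. \<forall>t. \<gamma> (t + T) = \<gamma> t"
    then obtain T where "T > 0" and T: "\<And>t. x (t + T) = x t" "\<And>t. y (t + T) = y t"
      by (auto simp: \<gamma> SE2_coords_eq_iff)
    have "((\<lambda>t. m * x t + n * y t) has_real_derivative (m * cos (\<theta> t) + n * sin (\<theta> t))\<^sup>2) (at t)" for t
      using dx dy by (auto intro!: derivative_eq_intros simp: power2_eq_square algebra_simps)
    then have "(m * cos (\<theta> t) + n * sin (\<theta> t))\<^sup>2 = 0" for t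
      by (rule periodic_deriv_nonneg_imp_deriv_zero[OF _ _ \<open>T > 0\<close>]) (simp_all add: T)
    then have c: "m * cos (\<theta> t) + n * sin (\<theta> t) = 0" for t
      by simp
    \<comment> \<open>Differentiating the identity \<open>c = 0\<close> brings in the component of
      the momentum orthogonal to the heading, multiplied by the angular speed \<open>p 0\<close>,
      which is nonzero by the energy equation.\<close>
    have "((\<lambda>t. m * cos (\<theta> t) + n * sin (\<theta> t)) has_real_derivative
        (n * cos (\<theta> 0) - m * sin (\<theta> 0)) * p 0) (at 0)"
      using d\<theta> by (auto intro!: derivative_eq_intros simp: algebra_simps)
    then have "(n * cos (\<theta> 0) - m * sin (\<theta> 0)) * p 0 = 0"
      unfolding c by (metis DERIV_const DERIV_unique)
    moreover have "p 0 \<noteq> 0"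
      using energy[of 0] c[of 0] by auto
    ultimately have s: "n * cos (\<theta> 0) - m * sin (\<theta> 0) = 0"
      by simp
    \<comment> \<open>Rotating the momentum into the moving frame preserves its norm, and both
      rotated components vanish.\<close>
    have "m\<^sup>2 + n\<^sup>2 = (m\<^sup>2 + n\<^sup>2) * ((sin (\<theta> 0))\<^sup>2 + (cos (\<theta> 0))\<^sup>2)"
      by simp
    also have "\<dots> = (m * cos (\<theta> 0) + n * sin (\<theta> 0))\<^sup>2 + (n * cos (\<theta> 0) - m * sin (\<theta> 0))\<^sup>2"
      by algebra
    also have "\<dots> = 0"
      by (simp add: c s)
    finally show "m = 0 \<and> n = 0"
      by (simp add: sum_power2_eq_zero_iff)
  next
    assume "m = 0 \<and> n = 0"
    then have "(x has_real_derivative 0) (at t)" "(y has_real_derivative 0) (at t)"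
      "(p has_real_derivative 0) (at t)" for t
      using dx[of t] dy[of t] dp[of t] by simp_all
    then have const: "x s = x t" "y s = y t" "p s = p t" for s t
      using DERIV_isconst_all[of x] DERIV_isconst_all[of y] DERIV_isconst_all[of p] by simp_all
    \<comment> \<open>As \<open>p\<close> is constant, \<open>\<theta>\<close> is affine with slope
      \<open>p 0\<close>.\<close>
    have "((\<lambda>t. \<theta> t - p 0 * t) has_real_derivative 0) (at t)" for t
      using DERIV_diff[OF d\<theta>[of t] DERIV_cmult_Id[of "p 0"]] const(3)[of t 0] by simp
    then have "\<theta> (t + 2 * pi) - p 0 * (t + 2 * pi) = \<theta> t - p 0 * t" for t
      using DERIV_isconst_all[of "\<lambda>t. \<theta> t - p 0 * t"] by simp
    then have shift: "\<theta> (t + 2 * pi) = \<theta> t + 2 * pi * p 0" for t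
      by (simp add: algebra_simps)
    have "p 0 = 1 \<or> p 0 = - 1"
      using energy[of 0] \<open>m = 0 \<and> n = 0\<close> by (simp add: power2_eq_1_iff)
    \<comment> \<open>An integer slope makes the shift of \<open>\<theta>\<close> over time
      \<open>2 * pi\<close> a multiple of \<open>2 * pi\<close>, which \<open>SE2_coords\<close>
      does not see.\<close>
    then obtain k :: int where k: "p 0 = of_int k"
      by (metis of_int_1 of_int_minus)
    have "\<gamma> (t + 2 * pi) = \<gamma> t" for t
      unfolding \<gamma> SE2_coords_eq_iff shift k using const(1,2)[of "t + 2 * pi" t] by blast
    then show "\<exists>T>0. \<forall>t. \<gamma> (t + T) = \<gamma> t"
      by (intro exI[of _ "2 * pi"]) simp
  qed
qed

theorem theorem1:
  fixes R \<delta> :: real and \<gamma> :: "real \<Rightarrow> (real^2^2) \<times> (real^2)"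
  assumes "R \<ge> 0" and "sR_geodesic_momentum (R * cos \<delta>, R * sin \<delta>) \<gamma>"
  shows "(\<exists>T>0. \<forall>t. \<gamma> (t + T) = \<gamma> t) \<longleftrightarrow> R = 0"
  unfolding periodic_sR_geodesic_iff[OF assms(2)]
  \<comment> \<open>\<open>sin \<delta>\<close> and \<open>cos \<delta>\<close> never vanish
    together, so the momentum is zero exactly when \<open>R\<close> is.\<close>
  using sin_zero_abs_cos_one[of \<delta>] by auto

end
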